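(* Let $\kappa$ be a field and let $S_1=\langle s_1,\ldots,s_n\rangle$ and $S_2=\langle t_1,\ldots,t_m\rangle$ be affine semigroups in $\mathbb{N}^d$. Consider the $\kappa$-algebra homomorphisms $$\varphi_1:\kappa[X_1,\ldots,X_n]\to\kappa[\mathbf{u}^{S_1}],\quad \varphi_2:\kappa[Y_1,\ldots,Y_m]\to\kappa[\mathbf{u}^{S_2}],\quad \varphi:\kappa[X_1,\ldots,X_n,Y_1,\ldots,Y_m]\to\kappa[\mathbf{u}^{S_1+S_2}]$$ given by $\varphi(X_i)=\varphi_1(X_i)=\mathbf{u}^{s_i}$ and $\varphi(Y_j)=\varphi_2(Y_j)=\mathbf{u}^{t_j}$. For any nonzero element $w=i_1s_1+\cdots+i_ns_n=j_1t_1+\cdots+j_mt_m$ in $S_1\cap S_2$ (with $i_1,\dots,i_n,j_1,\dots,j_m\in\mathbb{N}$), the following conditions are equivalent. (i) $\ker\varphi=\ker\varphi_1+\ker\varphi_2+\langle X_1^{i_1}\cdots X_n^{i_n}-Y_1^{j_1}\cdots Y_m^{j_m}\rangle$ as ideals of $\kappa[X_1,\ldots,X_n,Y_1,\ldots,Y_m]$. (ii) $\mathrm{Grp}(S_1)\cap\mathrm{Grp}(S_2)=\mathrm{Grp}(S)$, where $S=\mathbb{N}w$.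
   Context: $\mathbb{N}$ is the set of non-negative integers. An affine semigroup in $\mathbb{N}^d$ is a finitely generated submonoid (containing $0$) of $\mathbb{N}^d$; $\langle s_1,\dots,s_n\rangle$ is the submonoid generated by $s_1,\dots,s_n$. $\mathrm{Grp}(S)=\{s-t:s,t\in S\}\subseteq\mathbb{Z}^d$. $\kappa[\mathbf{u}^S]$ is the $\kappa$-subalgebra of $\kappa[u_1,\dots,u_d]$ spanned by the monomials $\mathbf{u}^s$, $s\in S$. In (i), $\ker\varphi_1$ and $\ker\varphi_2$ stand for the ideals they generate in $\kappa[X_1,\ldots,X_n,Y_1,\ldots,Y_m]$. *)

theory Defs
  imports "HOL-Analysis.Analysis" "HOL-Library.Poly_Mapping" "HOL-Library.Set_Algebras"
begin

text \<open>
  The polynomial ring over a field in variables indexed by a finite type \<open>'v\<close> is the monoid algebra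
  of the exponent vectors \<open>nat ^ 'v\<close>: finitely supported maps with convolution as product.
  The disjoint union of two families of variables is indexed by a sum type.
\<close>

type_synonym ('v, 'k) mpoly = "(nat ^ 'v) \<Rightarrow>\<^sub>0 'k"

definition mp_monom :: "nat ^ 'v \<Rightarrow> ('v::finite, 'k::field) mpoly" where
  "mp_monom e = Poly_Mapping.single e 1"

definition mp_var :: "'v \<Rightarrow> ('v::finite, 'k::field) mpoly" where
  "mp_var v = mp_monom (axis v 1)"

definition kscale :: "'k \<Rightarrow> ('v::finite, 'k::field) mpoly \<Rightarrow> ('v, 'k) mpoly" where
  "kscale c f = Poly_Mapping.single 0 c * f"

lemma module_kscale: "module (kscale :: 'k \<Rightarrow> ('v::finite, 'k::field) mpoly \<Rightarrow> _)"
  by unfold_locales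
    (simp_all add: kscale_def distrib_left distrib_right single_add mult_single flip: mult.assoc)

definition kalg_hom ::
    "(('v::finite, 'k::field) mpoly \<Rightarrow> ('w::finite, 'k) mpoly) \<Rightarrow> ('w, 'k) mpoly set \<Rightarrow> bool" where
  "kalg_hom \<phi> A \<longleftrightarrow>
     module_hom kscale kscale \<phi> \<and> \<phi> 1 = 1 \<and> (\<forall>f g. \<phi> (f * g) = \<phi> f * \<phi> g) \<and> range \<phi> \<subseteq> A"

definition ker :: "('a \<Rightarrow> 'b::zero) \<Rightarrow> 'a set" where
  "ker \<phi> = {f. \<phi> f = 0}"

definition ideal_gen :: "'a::comm_ring_1 set \<Rightarrow> 'a set" where
  "ideal_gen B = module.span (*) B"

definition mp_subst :: "('v \<Rightarrow> ('w, 'k) mpoly) \<Rightarrow> ('v::finite, 'k::field) mpoly \<Rightarrow> ('w::finite, 'k) mpoly" where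
  "mp_subst g f = (\<Sum>e\<in>Poly_Mapping.keys f. kscale (Poly_Mapping.lookup f e) (\<Prod>v\<in>UNIV. g v ^ (e $ v)))"

text \<open>The inclusions of the polynomial rings in each family of variables into the joint one.\<close>

definition inclX :: "('n::finite, 'k::field) mpoly \<Rightarrow> ('n + 'm::finite, 'k) mpoly" where
  "inclX = mp_subst (\<lambda>i. mp_var (Inl i))"

definition inclY :: "('m::finite, 'k::field) mpoly \<Rightarrow> ('n::finite + 'm, 'k) mpoly" where
  "inclY = mp_subst (\<lambda>j. mp_var (Inr j))"

definition add_submonoid :: "'a::comm_monoid_add set \<Rightarrow> bool" where
  "add_submonoid M \<longleftrightarrow> 0 \<in> M \<and> (\<forall>x\<in>M. \<forall>y\<in>M. x + y \<in> M)"

definition monoid_gen :: "'a::comm_monoid_add set \<Rightarrow> 'a set" where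
  "monoid_gen B = add_submonoid hull B"

definition Grp :: "(nat ^ 'd) set \<Rightarrow> (int ^ 'd) set" where
  "Grp S = {(\<chi> l. int (x $ l) - int (y $ l)) | x y. x \<in> S \<and> y \<in> S}"

definition semigroup_ring :: "(nat ^ 'd) set \<Rightarrow> ('d::finite, 'k::field) mpoly set" where
  "semigroup_ring S = module.span kscale (mp_monom ` S)"

text \<open>
  For any choice of images \<open>mp_monom (a v)\<close> of the variables, with all \<open>a v\<close> in a submonoid \<open>S\<close>, an
  algebra homomorphism into \<open>semigroup_ring S\<close> with these values exists, namely \<open>mp_subst\<close>; see
  \<open>mp_subst_var\<close> and \<open>kalg_hom_mp_subst\<close>.
\<close>

lemma module_times: "module ((*) :: 'a::comm_ring_1 \<Rightarrow> 'a \<Rightarrow> 'a)"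
  by unfold_locales (simp_all add: algebra_simps)

lemma mp_subst_superset:
  assumes "finite A" "Poly_Mapping.keys f \<subseteq> A"
  shows "mp_subst g f = (\<Sum>e\<in>A. kscale (Poly_Mapping.lookup f e) (\<Prod>v\<in>UNIV. g v ^ (e $ v)))"
  unfolding mp_subst_def using assms
  by (intro sum.mono_neutral_left) (auto simp: kscale_def in_keys_iff)

lemma mp_subst_add: "mp_subst g (f + h) = mp_subst g f + mp_subst g h"
proof -
  let ?A = "Poly_Mapping.keys f \<union> Poly_Mapping.keys h"
  have "Poly_Mapping.keys (f + h) \<subseteq> ?A"
    by (rule Poly_Mapping.keys_add)
  then show ?thesis
    by (simp add: mp_subst_superset[of ?A] lookup_add kscale_def single_add distrib_right sum.distrib)
qed

lemma mp_subst_single: "mp_subst g (Poly_Mapping.single e c) = kscale c (\<Prod>v\<in>UNIV. g v ^ (e $ v))"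
  by (subst mp_subst_superset[of "{e}"]) (auto simp: lookup_single)

lemma mp_subst_zero: "mp_subst g 0 = 0"
  by (simp add: mp_subst_def)

lemma poly_mapping_add_induct:
  fixes f :: "'a \<Rightarrow>\<^sub>0 'b::comm_monoid_add"
  assumes "P 0" "\<And>k c. P (Poly_Mapping.single k c)" "\<And>f g. P f \<Longrightarrow> P g \<Longrightarrow> P (f + g)"
  shows "P f"
proof -
  have *: "P (\<Sum>k\<in>A. Poly_Mapping.single k (Poly_Mapping.lookup f k))" if "finite A" for A
    using that by (induction A) (auto intro: assms)
  have "f = (\<Sum>k\<in>Poly_Mapping.keys f. Poly_Mapping.single k (Poly_Mapping.lookup f k))"
    by (rule poly_mapping_eqI)
      (simp add: lookup_sum lookup_single when_def in_keys_iff)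
  then show ?thesis using *[OF finite_keys] by metis
qed

lemma kscale_mult:
  fixes p q :: "('v::finite, 'k::field) mpoly"
  shows "kscale (a * b) (p * q) = kscale a p * kscale b q"
proof -
  have "Poly_Mapping.single (0 :: nat ^ 'v) (a * b) = Poly_Mapping.single 0 a * Poly_Mapping.single 0 b"
    by (simp add: mult_single)
  then show ?thesis
    by (simp add: kscale_def mult_ac)
qed

lemma mp_subst_mult: "mp_subst g (f * h) = mp_subst g f * mp_subst g h"
proof (induction f rule: poly_mapping_add_induct)
  case (2 k c)
  show ?case
  proof (induction h rule: poly_mapping_add_induct)
    case (2 l b)
    show ?case
      by (simp add: mult_single mp_subst_single power_add prod.distrib kscale_mult)
  qed (simp_all add: mp_subst_zero mp_subst_add distrib_left)
qed (simp_all add: mp_subst_zero mp_subst_add distrib_right)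

lemma mp_subst_var: "mp_subst g (mp_var v) = g v"
proof -
  have "(\<Prod>u\<in>UNIV. g u ^ (axis v (1::nat) $ u)) = (\<Prod>u\<in>UNIV. if u = v then g u else 1)"
    by (intro prod.cong) (auto simp: axis_def)
  then show ?thesis
    by (simp add: mp_var_def mp_monom_def mp_subst_single kscale_def)
qed

lemma add_submonoid_monoid_gen: "add_submonoid (monoid_gen B)"
  unfolding monoid_gen_def by (rule hull_in) (auto simp: add_submonoid_def)

lemma kalg_hom_mp_subst:
  assumes "add_submonoid S" "\<And>v. a v \<in> S"
  shows "kalg_hom (mp_subst (\<lambda>v. mp_monom (a v)) :: ('v::finite, 'k::field) mpoly \<Rightarrow> ('d::finite, 'k) mpoly)
           (semigroup_ring S)"
proof -
  let ?\<phi> = "mp_subst (\<lambda>v. mp_monom (a v)) :: ('v, 'k) mpoly \<Rightarrow> ('d, 'k) mpoly"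
  interpret K: module "kscale :: 'k \<Rightarrow> ('d, 'k) mpoly \<Rightarrow> _" by (rule module_kscale)
  have scale: "?\<phi> (kscale c f) = kscale c (?\<phi> f)" for c f
    by (simp add: kscale_def mp_subst_mult mp_subst_single)
  have one: "?\<phi> 1 = 1"
    using mp_subst_single[of _ 0 1] by (simp add: kscale_def)
  have add: "x + y \<in> S" if "x \<in> S" "y \<in> S" for x y
    using assms(1) that by (simp add: add_submonoid_def)
  have zero: "0 \<in> S"
    using assms(1) by (simp add: add_submonoid_def)
  have pow: "\<exists>x\<in>S. (mp_monom b :: ('d, 'k) mpoly) ^ p = mp_monom x" if "b \<in> S" for b p
    using that by (induction p) (auto simp: mp_monom_def mult_single intro: add zero bexI[of _ 0])
  have prod: "\<exists>x\<in>S. (\<Prod>v\<in>V. (mp_monom (a v) :: ('d, 'k) mpoly) ^ (e v)) = mp_monom x" if "finite V" for V e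
    using that
  proof (induction V)
    case empty
    then show ?case using zero by (auto simp: mp_monom_def intro: bexI[of _ 0])
  next
    case (insert v V)
    then obtain x where x: "x \<in> S" "(\<Prod>v\<in>V. (mp_monom (a v) :: ('d, 'k) mpoly) ^ (e v)) = mp_monom x"
      by blast
    obtain y where y: "y \<in> S" "(mp_monom (a v) :: ('d, 'k) mpoly) ^ e v = mp_monom y"
      using pow[OF assms(2)] by blast
    show ?case
      using x y insert by (intro bexI[of _ "y + x"]) (auto simp: mp_monom_def mult_single add)
  qed
  have "?\<phi> f \<in> semigroup_ring S" for f
    unfolding mp_subst_def semigroup_ring_def
  proof (intro K.span_sum K.span_scale)
    fix e
    obtain x where "x \<in> S" "(\<Prod>v\<in>UNIV. (mp_monom (a v) :: ('d, 'k) mpoly) ^ (e $ v)) = mp_monom x"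
      using prod[of UNIV "\<lambda>v. e $ v"] by auto
    then show "(\<Prod>v\<in>UNIV. (mp_monom (a v) :: ('d, 'k) mpoly) ^ (e $ v)) \<in> K.span (mp_monom ` S)"
      by (auto intro: K.span_base)
  qed
  then show ?thesis
    unfolding kalg_hom_def
    by (auto simp: module_hom_def module_hom_axioms_def module_kscale mp_subst_add scale one mp_subst_mult)
qed

end

theory Submission
  imports Defs
begin

text \<open>
  Write \<open>deg\<close> for the weight in \<open>\<nat>\<^sup>d\<close> of an exponent vector, the variables being weighted by the
  generators of the semigroup. A homomorphism sending variables to monomials sends the monomial with
  exponent \<open>e\<close> to the one with exponent \<open>deg e\<close>, so it merely pushes coefficients forward along \<open>deg\<close>
  (\<open>kalg_hom_eq_pushforward\<close>). For any map \<open>D\<close> on exponents, whether into a monoid or just into the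
  set of classes of an equivalence relation, the kernel of the pushforward along \<open>D\<close> consists of the
  sums of binomials \<open>c (Z^e - Z^e')\<close> with \<open>D e = D e'\<close> (\<open>ker_pushforward_induct\<close>), and such kernels
  are included in each other exactly as the relations \<open>D e = D e'\<close> are
  (\<open>ker_pushforward_subset_iff\<close>).

  Both ideals of the theorem are of this form. For \<open>ker \<phi>\<close> the relation is equality of the total
  weight \<open>deg x + deg y\<close> of \<open>e = (x, y)\<close>. For the sum of the three ideals it is the relation
  \<open>glue_rel\<close>: the pairs \<open>(deg x, deg y)\<close> of \<open>e\<close> and \<open>e'\<close> differ by an integer multiple of \<open>(w, -w)\<close>
  (\<open>glued_ideal_eq_ker_pushforward\<close>). Indeed each of the three ideals is generated by binomials whose
  terms are related. Conversely, let \<open>deg x' = deg x + k w\<close> and \<open>deg y = deg y' + k w\<close>, and let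
  \<open>p\<close> and \<open>q\<close> be the exponents with entries \<open>i\<close> and \<open>j\<close>, both of weight \<open>w\<close>. Then
  \<open>X^x' Y^y' \<equiv> X^(x + k p) Y^y' \<equiv> X^x Y^(y' + k q) \<equiv> X^x Y^y\<close> modulo the first, third and second
  ideal respectively; the middle step uses that \<open>X^p - Y^q\<close> divides \<open>X^(k p) - Y^(k q)\<close>.

  Hence the ideals agree iff any two exponents of equal total weight are related by \<open>glue_rel\<close>. Such
  a pair of exponents is the same as two ways \<open>deg x - deg x' = deg y' - deg y\<close> of writing an element
  of \<open>Grp S1 \<inter> Grp S2\<close> as a difference, and it is related iff that element is an integer multiple of \<open>w\<close>
  (\<open>Grp_inter_eq_iff_glue_rel\<close>).
\<close>

section \<open>Pushforwards and the binomials in their kernels\<close>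

definition pushforward :: "('a \<Rightarrow> 'b) \<Rightarrow> ('a \<Rightarrow>\<^sub>0 'k::comm_monoid_add) \<Rightarrow> ('b \<Rightarrow>\<^sub>0 'k)" where
  "pushforward D f = (\<Sum>e\<in>Poly_Mapping.keys f. Poly_Mapping.single (D e) (Poly_Mapping.lookup f e))"

lemma pushforward_superset:
  assumes "finite A" "Poly_Mapping.keys f \<subseteq> A"
  shows "pushforward D f = (\<Sum>e\<in>A. Poly_Mapping.single (D e) (Poly_Mapping.lookup f e))"
  unfolding pushforward_def using assms
  by (intro sum.mono_neutral_left) (auto simp: in_keys_iff)

lemma pushforward_zero [simp]: "pushforward D 0 = 0"
  by (simp add: pushforward_def)

lemma pushforward_single [simp]:
  "pushforward D (Poly_Mapping.single e c) = Poly_Mapping.single (D e) c"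
  by (subst pushforward_superset[of "{e}"]) (auto simp: lookup_single)

lemma pushforward_add [simp]: "pushforward D (f + g) = pushforward D f + pushforward D g"
proof -
  let ?A = "Poly_Mapping.keys f \<union> Poly_Mapping.keys g"
  have "Poly_Mapping.keys (f + g) \<subseteq> ?A"
    by (rule Poly_Mapping.keys_add)
  then show ?thesis
    by (simp add: pushforward_superset[of ?A] lookup_add single_add sum.distrib)
qed

lemma pushforward_diff [simp]:
  fixes f g :: "'a \<Rightarrow>\<^sub>0 'k::ab_group_add"
  shows "pushforward D (f - g) = pushforward D f - pushforward D g"
  using pushforward_add[of D "f - g" g] by (simp add: eq_diff_eq)

lemma pushforward_comp: "pushforward D (pushforward D' f) = pushforward (D \<circ> D') f"
  by (induction f rule: poly_mapping_add_induct) simp_all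

text \<open>
  Fix a representative \<open>r e\<close> in each fibre of \<open>D\<close>. Moving every term of \<open>f\<close> to the representative
  changes \<open>f\<close> by a sum of binomials with equal \<open>D\<close>-values and yields the pushforward along \<open>r\<close>, which
  factors through \<open>D\<close> and hence vanishes when \<open>f\<close> is in the kernel.
\<close>

lemma ker_pushforward_induct [consumes 1, case_names zero add binomial]:
  fixes f :: "'a \<Rightarrow>\<^sub>0 'k::ab_group_add"
  assumes "f \<in> ker (pushforward D)"
    and "P 0"
    and "\<And>f g. P f \<Longrightarrow> P g \<Longrightarrow> P (f + g)"
    and "\<And>e e' c. D e = D e' \<Longrightarrow> P (Poly_Mapping.single e c - Poly_Mapping.single e' c)"
  shows "P f"
proof -
  define r where "r = inv D \<circ> D"
  have D_r: "D (r e) = D e" for e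
    by (simp add: r_def f_inv_into_f)
  have "pushforward r f = 0"
    using assms(1) by (simp add: r_def ker_def flip: pushforward_comp)
  moreover have "P (f - pushforward r f)"
  proof (induction f rule: poly_mapping_add_induct)
    case (3 f g)
    have "f + g - pushforward r (f + g) = (f - pushforward r f) + (g - pushforward r g)"
      by simp
    then show ?case using 3 assms(3) by metis
  qed (simp_all add: assms(2,4) D_r)
  ultimately show ?thesis by simp
qed

text \<open>
  Kernels of pushforwards compare as the equivalence relations that the maps induce, since each
  kernel both consists of sums of binomials and records, through them, which pairs are identified.
\<close>

lemma ker_pushforward_subset_iff:
  fixes D :: "'a \<Rightarrow> 'b" and D' :: "'a \<Rightarrow> 'c"
  shows "(ker (pushforward D) :: ('a \<Rightarrow>\<^sub>0 'k::comm_ring_1) set) \<subseteq> ker (pushforward D')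
    \<longleftrightarrow> (\<forall>e e'. D e = D e' \<longrightarrow> D' e = D' e')" (is "?A \<subseteq> ?B \<longleftrightarrow> ?C")
proof
  assume sub: "?A \<subseteq> ?B"
  show ?C
  proof (intro allI impI)
    fix e e' assume "D e = D e'"
    then have "(Poly_Mapping.single e 1 - Poly_Mapping.single e' 1 :: 'a \<Rightarrow>\<^sub>0 'k) \<in> ?A"
      by (simp add: ker_def)
    with sub have "(Poly_Mapping.single e 1 - Poly_Mapping.single e' 1 :: 'a \<Rightarrow>\<^sub>0 'k) \<in> ?B"
      by (rule subsetD)
    then have "(Poly_Mapping.single (D' e) 1 :: 'c \<Rightarrow>\<^sub>0 'k) = Poly_Mapping.single (D' e') 1"
      by (simp add: ker_def)
    then show "D' e = D' e'"
      by (metis keys_single one_neq_zero singleton_inject)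
  qed
next
  assume ?C
  show "?A \<subseteq> ?B"
  proof
    fix f assume "f \<in> ?A"
    then show "f \<in> ?B"
    proof (induction rule: ker_pushforward_induct)
      case (binomial e e' c)
      then have "D' e = D' e'"
        using \<open>?C\<close> by blast
      then show ?case by (simp add: ker_def)
    qed (simp_all add: ker_def)
  qed
qed

text \<open>
  For a congruence \<open>D\<close> with no monoid structure chosen on its classes, the pushforward is not a ring
  homomorphism, but its kernel is still an ideal: a monomial multiple of a binomial of the kernel
  is again one.
\<close>

lemma ker_pushforward_mult:
  fixes f :: "'a::cancel_comm_monoid_add \<Rightarrow>\<^sub>0 'k::comm_ring_1"
  assumes cong: "\<And>e e' g. D e = D e' \<Longrightarrow> D (g + e) = D (g + e')"
    and f: "f \<in> ker (pushforward D)"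
  shows "h * f \<in> ker (pushforward D)"
proof (induction h rule: poly_mapping_add_induct)
  case (2 g b)
  show ?case
    using f
  proof (induction rule: ker_pushforward_induct)
    case (binomial e e' c)
    then show ?case
      using cong[of e e' g] by (simp add: ker_def right_diff_distrib mult_single)
  qed (auto simp: ker_def distrib_left)
qed (auto simp: ker_def distrib_right)

section \<open>Ideals\<close>

lemma ideal_gen_Un: "ideal_gen (A \<union> B) = ideal_gen A + ideal_gen B"
  unfolding ideal_gen_def module.span_Un[OF module_times] set_plus_def by auto

lemma ideal_gen_subset_ker_pushforward:
  fixes B :: "('a::cancel_comm_monoid_add \<Rightarrow>\<^sub>0 'k::comm_ring_1) set"
  assumes "\<And>e e' g. D e = D e' \<Longrightarrow> D (g + e) = D (g + e')"
    and "B \<subseteq> ker (pushforward D)"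
  shows "ideal_gen B \<subseteq> ker (pushforward D)"
  unfolding ideal_gen_def
proof (rule module.span_minimal[OF module_times assms(2)])
  show "module.subspace (*) (ker (pushforward D :: ('a \<Rightarrow>\<^sub>0 'k) \<Rightarrow> _))"
  proof (rule module.subspaceI[OF module_times])
    show "h * f \<in> ker (pushforward D)" if "f \<in> ker (pushforward D)" for h f :: "'a \<Rightarrow>\<^sub>0 'k"
      using assms(1) that by (rule ker_pushforward_mult)
  qed (simp_all add: ker_def)
qed

section \<open>Homomorphisms sending variables to monomials\<close>

definition wdeg :: "('v::finite \<Rightarrow> nat ^ 'd) \<Rightarrow> nat ^ 'v \<Rightarrow> nat ^ 'd" where
  "wdeg a e = (\<Sum>v\<in>UNIV. e $ v *s a v)"

lemma wdeg_0 [simp]: "wdeg a 0 = 0"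
  by (simp add: wdeg_def vec_eq_iff)

lemma wdeg_add [simp]: "wdeg a (e + e') = wdeg a e + wdeg a e'"
  by (simp add: wdeg_def vector_sadd_rdistrib sum.distrib)

lemma wdeg_scale [simp]: "wdeg a (k *s e) = k *s wdeg a e"
  by (simp add: wdeg_def vec_eq_iff sum_distrib_left mult.assoc)

lemma wdeg_axis: "wdeg a (axis v 1) = a v"
proof -
  have "(\<Sum>u\<in>UNIV. axis v (1::nat) $ u *s a u) = (\<Sum>u\<in>UNIV. if u = v then a u else 0)"
    by (intro sum.cong) (auto simp: axis_def vec_eq_iff)
  then show ?thesis by (simp add: wdeg_def)
qed

text \<open>
  The semigroup is parametrised by exponent vectors, which lets differences of its elements be read
  as pairs of monomials.
\<close>

lemma monoid_gen_range: "monoid_gen (range a) = range (wdeg a)"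
proof
  have "add_submonoid (range (wdeg a))"
    unfolding add_submonoid_def by (auto simp flip: wdeg_add intro: range_eqI[of _ _ 0])
  moreover have "range a \<subseteq> range (wdeg a)"
    by (auto intro: range_eqI wdeg_axis[symmetric])
  ultimately show "monoid_gen (range a) \<subseteq> range (wdeg a)"
    unfolding monoid_gen_def by (intro hull_minimal)
next
  note M = add_submonoid_monoid_gen[of "range a", unfolded add_submonoid_def]
  have base: "a v \<in> monoid_gen (range a)" for v
    unfolding monoid_gen_def by (rule hull_inc) simp
  have scale: "k *s a v \<in> monoid_gen (range a)" for k :: nat and v
  proof (induction k)
    case (Suc k)
    have "Suc k *s a v = a v + k *s a v"
      by (simp add: vec_eq_iff)
    then show ?case using M base Suc by simp
  qed (use M in \<open>simp add: vec_eq_iff\<close>)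
  have "(\<Sum>v\<in>V. e $ v *s a v) \<in> monoid_gen (range a)" if "finite V" for V e
    using that by (induction V) (use M scale in auto)
  then show "range (wdeg a) \<subseteq> monoid_gen (range a)"
    by (auto simp: wdeg_def)
qed

lemma mp_monom_0: "mp_monom 0 = 1"
  by (simp add: mp_monom_def)

lemma mp_monom_add: "mp_monom (e + e') = mp_monom e * mp_monom e'"
  by (simp add: mp_monom_def mult_single)

lemma mp_monom_scale: "mp_monom (k *s e) = mp_monom e ^ k"
proof (induction k)
  case (Suc k)
  have "Suc k *s e = e + k *s e"
    by (simp add: vec_eq_iff)
  then show ?case using Suc by (simp add: mp_monom_add)
qed (simp add: mp_monom_0)

lemma mp_monom_wdeg:
  "mp_monom (wdeg a e) = (\<Prod>v\<in>UNIV. (mp_monom (a v) :: ('d::finite, 'k::field) mpoly) ^ (e $ v))"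
proof -
  have "mp_monom (\<Sum>v\<in>V. e $ v *s a v) = (\<Prod>v\<in>V. (mp_monom (a v) :: ('d, 'k) mpoly) ^ (e $ v))"
    if "finite V" for V
    using that by (induction V) (simp_all add: mp_monom_0 mp_monom_add mp_monom_scale)
  then show ?thesis by (simp add: wdeg_def)
qed

lemma kscale_mp_monom: "kscale c (mp_monom e) = Poly_Mapping.single e c"
  by (simp add: kscale_def mp_monom_def mult_single)

lemma mp_subst_monoms: "mp_subst (\<lambda>v. mp_monom (a v)) f = pushforward (wdeg a) f"
  by (simp add: mp_subst_def pushforward_def kscale_mp_monom flip: mp_monom_wdeg)

lemma mp_monom_eq_prod_var: "mp_monom e = (\<Prod>v\<in>UNIV. mp_var v ^ (e $ v))"
proof -
  have "wdeg (\<lambda>v. axis v 1) e = e"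
    by (simp add: wdeg_def vec_eq_iff axis_def if_distrib[of "(*) _"] cong: if_cong)
  then show ?thesis
    using mp_monom_wdeg[of "\<lambda>v. axis v 1" e] by (simp add: mp_var_def)
qed

text \<open>
  An algebra homomorphism is determined by its values on the variables, so the one given abstractly
  is the pushforward; all further work is about exponents.
\<close>

lemma kalg_hom_eq_pushforward:
  fixes \<phi> :: "('v::finite, 'k::field) mpoly \<Rightarrow> ('d::finite, 'k) mpoly"
  assumes "kalg_hom \<phi> A" "\<And>v. \<phi> (mp_var v) = mp_monom (a v)"
  shows "\<phi> = pushforward (wdeg a)"
proof
  fix f
  interpret module_hom kscale kscale \<phi>
    using assms(1) by (simp add: kalg_hom_def)
  have one: "\<phi> 1 = 1" and mult: "\<phi> (f * g) = \<phi> f * \<phi> g" for f g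
    using assms(1) by (auto simp: kalg_hom_def)
  have pow: "\<phi> (f ^ k) = \<phi> f ^ k" for f k
    by (induction k) (simp_all add: one mult)
  have prod: "\<phi> (\<Prod>v\<in>V. g v) = (\<Prod>v\<in>V. \<phi> (g v))" if "finite V" for V and g :: "'v \<Rightarrow> _"
    using that by (induction V) (simp_all add: one mult)
  show "\<phi> f = pushforward (wdeg a) f"
  proof (induction f rule: poly_mapping_add_induct)
    case (2 e c)
    have "\<phi> (mp_monom e) = mp_monom (wdeg a e)"
      by (simp add: mp_monom_eq_prod_var[of e] prod pow assms(2) mp_monom_wdeg)
    then have "\<phi> (kscale c (mp_monom e)) = kscale c (mp_monom (wdeg a e))"
      by (simp add: scale)
    then show ?case by (simp add: kscale_mp_monom)
  qed (simp_all add: zero add)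
qed

section \<open>Exponents over a disjoint union of variables\<close>

definition join :: "nat ^ 'n \<Rightarrow> nat ^ 'm \<Rightarrow> nat ^ ('n::finite + 'm::finite)" where
  "join x y = (\<chi> v. case v of Inl a \<Rightarrow> x $ a | Inr b \<Rightarrow> y $ b)"

definition partX :: "nat ^ ('n::finite + 'm::finite) \<Rightarrow> nat ^ 'n" where
  "partX e = (\<chi> a. e $ Inl a)"

definition partY :: "nat ^ ('n::finite + 'm::finite) \<Rightarrow> nat ^ 'm" where
  "partY e = (\<chi> b. e $ Inr b)"

lemma parts_join [simp]: "partX (join x y) = x" "partY (join x y) = y"
  by (simp_all add: partX_def partY_def join_def vec_eq_iff)

lemma join_parts [simp]: "join (partX e) (partY e) = e"
  by (simp add: partX_def partY_def join_def vec_eq_iff split: sum.split)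

lemma parts_add [simp]: "partX (e + e') = partX e + partX e'" "partY (e + e') = partY e + partY e'"
  by (simp_all add: partX_def partY_def vec_eq_iff)

lemma join_add: "join x y + join x' y' = join (x + x') (y + y')"
  by (simp add: join_def vec_eq_iff split: sum.split)

lemma join_scale: "join (k *s x) 0 = k *s join x 0" "join 0 (k *s y) = k *s join 0 y"
  by (simp_all add: join_def vec_eq_iff split: sum.split)

lemma sum_UNIV_sum_type:
  "(\<Sum>v\<in>UNIV. f v) = (\<Sum>a\<in>UNIV. f (Inl a)) + (\<Sum>b\<in>UNIV. f (Inr b))"
  for f :: "'n::finite + 'm::finite \<Rightarrow> 'c::comm_monoid_add"
  by (subst UNIV_Plus_UNIV[symmetric]) (simp add: sum.Plus del: UNIV_Plus_UNIV)

lemma wdeg_sum_type: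
  "wdeg c e = wdeg (\<lambda>a. c (Inl a)) (partX e) + wdeg (\<lambda>b. c (Inr b)) (partY e)"
  by (simp add: wdeg_def sum_UNIV_sum_type partX_def partY_def)

lemma inclX_eq:
  "(inclX :: ('n::finite, 'k::field) mpoly \<Rightarrow> ('n + 'm::finite, 'k) mpoly) = pushforward (\<lambda>x. join x 0)"
proof -
  have "wdeg (\<lambda>a. axis (Inl a) 1) = (\<lambda>x. join x 0 :: nat ^ ('n + 'm))"
    by (auto simp: wdeg_def fun_eq_iff vec_eq_iff axis_def join_def if_distrib[of "(*) _"]
        split: sum.split cong: if_cong)
  then show ?thesis
    unfolding inclX_def mp_var_def mp_subst_monoms by simp
qed

lemma inclY_eq:
  "(inclY :: ('m::finite, 'k::field) mpoly \<Rightarrow> ('n::finite + 'm, 'k) mpoly) = pushforward (\<lambda>y. join 0 y)"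
proof -
  have "wdeg (\<lambda>b. axis (Inr b) 1) = (\<lambda>y. join 0 y :: nat ^ ('n + 'm))"
    by (auto simp: wdeg_def fun_eq_iff vec_eq_iff axis_def join_def if_distrib[of "(*) _"]
        split: sum.split cong: if_cong)
  then show ?thesis
    unfolding inclY_def mp_var_def mp_subst_monoms by simp
qed

section \<open>The gluing congruence\<close>

text \<open>
  The relation that the weight pairs \<open>(deg x, deg y)\<close> agree modulo \<open>\<int>(w, -w)\<close>. The integer multiple
  is written as \<open>l - k\<close> with natural \<open>k\<close>, \<open>l\<close>, distributed so that no subtraction occurs.
\<close>

definition glue_rel ::
    "('n::finite \<Rightarrow> nat ^ 'd) \<Rightarrow> ('m::finite \<Rightarrow> nat ^ 'd) \<Rightarrow> nat ^ 'd
      \<Rightarrow> nat ^ ('n + 'm) \<Rightarrow> nat ^ ('n + 'm) \<Rightarrow> bool" where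
  "glue_rel s t w e e' \<longleftrightarrow> (\<exists>k l :: nat.
     wdeg s (partX e) + k *s w = wdeg s (partX e') + l *s w \<and>
     wdeg t (partY e) + l *s w = wdeg t (partY e') + k *s w)"

lemma equivp_glue_rel: "equivp (glue_rel s t w)"
proof (rule equivpI)
  show "reflp (glue_rel s t w)"
    by (auto simp: reflp_def glue_rel_def)
  show "symp (glue_rel s t w)"
    unfolding symp_def glue_rel_def by metis
  show "transp (glue_rel s t w)"
  proof (rule transpI)
    fix e e' e'' assume "glue_rel s t w e e'" "glue_rel s t w e' e''"
    then obtain k l k' l' where
      s: "wdeg s (partX e) + k *s w = wdeg s (partX e') + l *s w"
        "wdeg s (partX e') + k' *s w = wdeg s (partX e'') + l' *s w" and
      t: "wdeg t (partY e) + l *s w = wdeg t (partY e') + k *s w"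
        "wdeg t (partY e') + l' *s w = wdeg t (partY e'') + k' *s w"
      unfolding glue_rel_def by blast
    have trans: "a + (n + n') *s w = c + (m + m') *s w"
      if "a + n *s w = b + m *s w" "b + n' *s w = c + m' *s w" for a b c and n n' m m' :: nat
    proof -
      have "(a + n *s w) + (b + n' *s w) = (b + m *s w) + (c + m' *s w)"
        by (simp only: that)
      then have "b + (a + (n + n') *s w) = b + (c + (m + m') *s w)"
        by (simp only: vector_sadd_rdistrib ac_simps)
      then show ?thesis by simp
    qed
    show "glue_rel s t w e e''"
      unfolding glue_rel_def using trans[OF s] trans[OF t] by blast
  qed
qed

text \<open>
  The partially applied relation maps an exponent to its class; this is the map along which
  coefficients are pushed forward.
\<close>

lemma glue_rel_class_eq_iff: "glue_rel s t w e = glue_rel s t w e' \<longleftrightarrow> glue_rel s t w e e'"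
  using equivp_glue_rel unfolding equivp_def by metis

lemma glue_rel_add: "glue_rel s t w e e' \<Longrightarrow> glue_rel s t w (g + e) (g + e')"
  unfolding glue_rel_def by (auto simp: add.assoc)

lemma glue_relE:
  assumes "glue_rel s t w e e'"
  obtains (left) k where "wdeg s (partX e) + k *s w = wdeg s (partX e')"
      "wdeg t (partY e) = wdeg t (partY e') + k *s w"
    | (right) k where "wdeg s (partX e') + k *s w = wdeg s (partX e)"
      "wdeg t (partY e') = wdeg t (partY e) + k *s w"
proof -
  obtain k l where kl:
    "wdeg s (partX e) + k *s w = wdeg s (partX e') + l *s w"
    "wdeg t (partY e) + l *s w = wdeg t (partY e') + k *s w"
    using assms by (auto simp: glue_rel_def)
  show ?thesis
  proof (cases "l \<le> k")
    case True
    then have "k *s w = (k - l) *s w + l *s w"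
      by (simp flip: vector_sadd_rdistrib)
    then show ?thesis
      using kl by (intro left[of "k - l"]) (simp_all flip: add.assoc)
  next
    case False
    then have "l *s w = (l - k) *s w + k *s w"
      by (simp flip: vector_sadd_rdistrib)
    then show ?thesis
      using kl by (intro right[of "l - k"]) (simp_all flip: add.assoc)
  qed
qed

lemma glue_rel_wdeg:
  assumes "glue_rel s t w e e'"
  shows "wdeg s (partX e) + wdeg t (partY e) = wdeg s (partX e') + wdeg t (partY e')"
  using assms by (cases rule: glue_relE) (metis add.assoc add.commute)+

text \<open>
  For exponents \<open>e = join x y'\<close> and \<open>e' = join x' y\<close>, equality of total weights says
  that \<open>x - x'\<close> and \<open>y - y'\<close> have the same weight, an element of both groups. Being related
  by \<open>glue_rel\<close> says that this element is an integer multiple of \<open>w\<close>.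
\<close>

lemma Grp_inter_eq_iff_glue_rel:
  fixes s :: "'n::finite \<Rightarrow> nat ^ 'd::finite" and t :: "'m::finite \<Rightarrow> nat ^ 'd"
  assumes w: "w \<in> range (wdeg s)" "w \<in> range (wdeg t)"
  shows "Grp (range (wdeg s)) \<inter> Grp (range (wdeg t)) = Grp {k *s w | k. True}
    \<longleftrightarrow> (\<forall>e e'. wdeg s (partX e) + wdeg t (partY e) = wdeg s (partX e') + wdeg t (partY e')
          \<longrightarrow> glue_rel s t w e e')" (is "?G1 \<inter> ?G2 = ?Gw \<longleftrightarrow> ?R")
proof -
  obtain p q where pq: "w = wdeg s p" "w = wdeg t q"
    using w by blast
  have "k *s w \<in> range (wdeg s)" "k *s w \<in> range (wdeg t)" for k
    by (simp add: pq(1) flip: wdeg_scale) (simp add: pq(2) flip: wdeg_scale)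
  then have "?Gw \<subseteq> ?G1 \<inter> ?G2"
    unfolding Grp_def by blast
  moreover have "?G1 \<inter> ?G2 \<subseteq> ?Gw \<longleftrightarrow> ?R"
  proof
    assume sub: "?G1 \<inter> ?G2 \<subseteq> ?Gw"
    show ?R
    proof (intro allI impI)
      fix e e' :: "nat ^ ('n + 'm)"
      assume eq: "wdeg s (partX e) + wdeg t (partY e) = wdeg s (partX e') + wdeg t (partY e')"
      define z :: "int ^ 'd" where
        "z = (\<chi> l. int (wdeg s (partX e) $ l) - int (wdeg s (partX e') $ l))"
      have eql: "wdeg s (partX e) $ l + wdeg t (partY e) $ l
          = wdeg s (partX e') $ l + wdeg t (partY e') $ l" for l
        using eq by (metis vector_add_component)
      have "z = (\<chi> l. int (wdeg t (partY e') $ l) - int (wdeg t (partY e) $ l))"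
        unfolding z_def vec_eq_iff vec_lambda_beta
      proof
        fix l
        show "int (wdeg s (partX e) $ l) - int (wdeg s (partX e') $ l)
            = int (wdeg t (partY e') $ l) - int (wdeg t (partY e) $ l)"
          using eql[of l] by linarith
      qed
      then have "z \<in> ?G1 \<inter> ?G2"
        unfolding Grp_def using z_def by blast
      then have "z \<in> ?Gw" using sub by blast
      then obtain k l where "z = (\<chi> m. int ((l *s w) $ m) - int ((k *s w) $ m))"
        unfolding Grp_def by blast
      then have zm: "int (wdeg s (partX e) $ m) - int (wdeg s (partX e') $ m)
          = int ((l *s w) $ m) - int ((k *s w) $ m)" for m
        by (simp add: z_def vec_eq_iff)
      show "glue_rel s t w e e'"
        unfolding glue_rel_def
      proof (intro exI conjI)
        show "wdeg s (partX e) + k *s w = wdeg s (partX e') + l *s w"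
          unfolding vec_eq_iff vector_add_component
        proof
          fix m show "wdeg s (partX e) $ m + (k *s w) $ m = wdeg s (partX e') $ m + (l *s w) $ m"
            using zm[of m] by linarith
        qed
        show "wdeg t (partY e) + l *s w = wdeg t (partY e') + k *s w"
          unfolding vec_eq_iff vector_add_component
        proof
          fix m show "wdeg t (partY e) $ m + (l *s w) $ m = wdeg t (partY e') $ m + (k *s w) $ m"
            using zm[of m] eql[of m] by linarith
        qed
      qed
    qed
  next
    assume R: ?R
    show "?G1 \<inter> ?G2 \<subseteq> ?Gw"
    proof
      fix z assume "z \<in> ?G1 \<inter> ?G2"
      then obtain x x' y y' where
        zx: "z = (\<chi> l. int (wdeg s x $ l) - int (wdeg s x' $ l))" and
        zy: "z = (\<chi> l. int (wdeg t y $ l) - int (wdeg t y' $ l))"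
        unfolding Grp_def by blast
      have "wdeg s x + wdeg t y' = wdeg s x' + wdeg t y"
        unfolding vec_eq_iff vector_add_component
      proof
        fix l
        have "int (wdeg s x $ l) - int (wdeg s x' $ l) = int (wdeg t y $ l) - int (wdeg t y' $ l)"
          using zx zy by (simp add: vec_eq_iff)
        then show "wdeg s x $ l + wdeg t y' $ l = wdeg s x' $ l + wdeg t y $ l"
          by linarith
      qed
      then have "glue_rel s t w (join x y') (join x' y)"
        using R by simp
      then obtain k l where kl: "wdeg s x + k *s w = wdeg s x' + l *s w"
        by (auto simp: glue_rel_def)
      have "z = (\<chi> m. int ((l *s w) $ m) - int ((k *s w) $ m))"
        unfolding zx vec_eq_iff vec_lambda_beta
      proof
        fix m
        have "wdeg s x $ m + (k *s w) $ m = wdeg s x' $ m + (l *s w) $ m"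
          using kl by (metis vector_add_component)
        then show "int (wdeg s x $ m) - int (wdeg s x' $ m) = int ((l *s w) $ m) - int ((k *s w) $ m)"
          by linarith
      qed
      then show "z \<in> ?Gw"
        unfolding Grp_def by blast
    qed
  qed
  ultimately show ?thesis by blast
qed

text \<open>
  The kernels on the left are themselves sums of binomials, so the left side is generated by
  binomials whose terms \<open>glue_rel\<close> identifies. For the other inclusion, a binomial of related
  monomials is telescoped: factors \<open>X^p\<close> are split off inside \<open>X\<close> (first ideal), traded for
  factors \<open>Y^q\<close> (third ideal), and absorbed inside \<open>Y\<close> (second ideal).
\<close>

lemma glued_ideal_eq_ker_pushforward:
  fixes s :: "'n::finite \<Rightarrow> nat ^ 'd::finite" and t :: "'m::finite \<Rightarrow> nat ^ 'd"
  assumes p: "wdeg s p = w" and q: "wdeg t q = w"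
  shows "ideal_gen (inclX ` ker (pushforward (wdeg s))) + ideal_gen (inclY ` ker (pushforward (wdeg t)))
      + ideal_gen {mp_monom (join p 0) - mp_monom (join 0 q)}
    = (ker (pushforward (glue_rel s t w)) :: ('n + 'm, 'k::field) mpoly set)"
proof -
  let ?b = "mp_monom (join p 0) - mp_monom (join 0 q) :: ('n + 'm, 'k) mpoly"
  let ?J = "ker (pushforward (glue_rel s t w)) :: ('n + 'm, 'k) mpoly set"
  define B where "B = inclX ` ker (pushforward (wdeg s)) \<union> inclY ` ker (pushforward (wdeg t)) \<union> {?b}"
  interpret I: module "(*) :: ('n + 'm, 'k) mpoly \<Rightarrow> _" by (rule module_times)
  have "ideal_gen B \<subseteq> ?J"
  proof (rule ideal_gen_subset_ker_pushforward)
    show "glue_rel s t w (g + e) = glue_rel s t w (g + e')"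
      if "glue_rel s t w e = glue_rel s t w e'" for e e' g
      using that by (simp add: glue_rel_class_eq_iff glue_rel_add)
    have "inclX f \<in> ?J" if "f \<in> ker (pushforward (wdeg s))" for f
      using that
    proof (induction rule: ker_pushforward_induct)
      case (binomial x x' c)
      then have "glue_rel s t w (join x 0) (join x' 0)"
        unfolding glue_rel_def by (intro exI[of _ 0]) simp
      then show ?case
        by (simp add: inclX_eq ker_def glue_rel_class_eq_iff[symmetric])
    qed (simp_all add: inclX_eq ker_def)
    moreover have "inclY f \<in> ?J" if "f \<in> ker (pushforward (wdeg t))" for f
      using that
    proof (induction rule: ker_pushforward_induct)
      case (binomial y y' c)
      then have "glue_rel s t w (join 0 y) (join 0 y')"
        unfolding glue_rel_def by (intro exI[of _ 0]) simp
      then show ?case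
        by (simp add: inclY_eq ker_def glue_rel_class_eq_iff[symmetric])
    qed (simp_all add: inclY_eq ker_def)
    moreover have "glue_rel s t w (join p 0) (join 0 q)"
      unfolding glue_rel_def by (intro exI[of _ 0] exI[of _ 1]) (simp add: p q vec_eq_iff)
    then have "?b \<in> ?J"
      by (simp add: ker_def mp_monom_def glue_rel_class_eq_iff[symmetric])
    ultimately show "B \<subseteq> ?J"
      by (auto simp: B_def)
  qed
  moreover have "?J \<subseteq> ideal_gen B"
  proof
    have mult: "h * f \<in> ideal_gen B" if "f \<in> ideal_gen B" for f h
      using that unfolding ideal_gen_def by (rule I.span_scale)
    have base: "f \<in> ideal_gen B" if "f \<in> B" for f
      using that unfolding ideal_gen_def by (rule I.span_base)
    have add: "f + g \<in> ideal_gen B" if "f \<in> ideal_gen B" "g \<in> ideal_gen B" for f g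
      using that unfolding ideal_gen_def by (rule I.span_add)
    have X: "mp_monom (join x y) - mp_monom (join x' y) \<in> ideal_gen B"
      if "wdeg s x = wdeg s x'" for x x' y
    proof -
      have "mp_monom x - mp_monom x' \<in> ker (pushforward (wdeg s) :: ('n, 'k) mpoly \<Rightarrow> _)"
        using that by (simp add: ker_def mp_monom_def)
      then have "mp_monom (join 0 y) * inclX (mp_monom x - mp_monom x') \<in> ideal_gen B"
        by (intro mult base) (auto simp: B_def)
      then show ?thesis
        by (simp add: inclX_eq mp_monom_def right_diff_distrib mult_single join_add)
    qed
    have Y: "mp_monom (join x y) - mp_monom (join x y') \<in> ideal_gen B"
      if "wdeg t y = wdeg t y'" for x y y'
    proof -
      have "mp_monom y - mp_monom y' \<in> ker (pushforward (wdeg t) :: ('m, 'k) mpoly \<Rightarrow> _)"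
        using that by (simp add: ker_def mp_monom_def)
      then have "mp_monom (join x 0) * inclY (mp_monom y - mp_monom y') \<in> ideal_gen B"
        by (intro mult base) (auto simp: B_def)
      then show ?thesis
        by (simp add: inclY_eq mp_monom_def right_diff_distrib mult_single join_add)
    qed
    have XY: "mp_monom (join (x + k *s p) y) - mp_monom (join x (y + k *s q)) \<in> ideal_gen B" for x y k
    proof -
      let ?P = "mp_monom (join p 0) :: ('n + 'm, 'k) mpoly" and ?Q = "mp_monom (join 0 q)"
      have "?P ^ k - ?Q ^ k = (\<Sum>i<k. ?Q ^ (k - Suc i) * ?P ^ i) * ?b"
        by (subst power_diff_sumr2) (simp add: mult.commute)
      moreover have "?b \<in> ideal_gen B"
        by (intro base) (simp add: B_def)
      ultimately have "mp_monom (join x y) * (?P ^ k - ?Q ^ k) \<in> ideal_gen B"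
        by (simp only: mult)
      then show ?thesis
        by (simp add: right_diff_distrib join_add
            flip: mp_monom_scale mp_monom_add join_scale)
    qed
    have step: "mp_monom e - mp_monom e' \<in> ideal_gen B"
      if "wdeg s (partX e) + k *s w = wdeg s (partX e')"
        "wdeg t (partY e) = wdeg t (partY e') + k *s w" for e e' k
    proof -
      define x y x' y' where "x = partX e" "y = partY e" "x' = partX e'" "y' = partY e'"
      note xy_defs = this
      have "mp_monom (join x' y') - mp_monom (join (x + k *s p) y') \<in> ideal_gen B"
        using that by (intro X) (simp add: xy_defs p)
      from add[OF this XY[of x k y']]
      have "mp_monom (join x' y') - mp_monom (join x (y' + k *s q)) \<in> ideal_gen B"
        by simp
      moreover have "mp_monom (join x (y' + k *s q)) - mp_monom (join x y) \<in> ideal_gen B"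
        using that by (intro Y) (simp add: xy_defs q)
      ultimately have "mp_monom (join x' y') - mp_monom (join x y) \<in> ideal_gen B"
        using add by fastforce
      from mult[OF this, of "-1"] show ?thesis
        by (simp add: xy_defs)
    qed
    fix f assume "f \<in> ?J"
    then show "f \<in> ideal_gen B"
    proof (induction rule: ker_pushforward_induct)
      case zero
      show ?case unfolding ideal_gen_def by (rule I.span_zero)
    next
      case (binomial e e' c)
      then have "glue_rel s t w e e'"
        by (simp add: glue_rel_class_eq_iff)
      then have "mp_monom e - mp_monom e' \<in> ideal_gen B"
      proof (cases rule: glue_relE)
        case (right k)
        from mult[OF step[OF right], of "-1"] show ?thesis by simp
      qed (rule step)
      from mult[OF this, of "Poly_Mapping.single 0 c"] show ?case
        by (simp add: right_diff_distrib mp_monom_def mult_single)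
    qed (rule add)
  qed
  ultimately have "ideal_gen B = ?J" by (rule subset_antisym)
  then show ?thesis unfolding B_def ideal_gen_Un .
qed

section \<open>The criterion for gluing\<close>

theorem lemma5p4:
  fixes s :: "'n::finite \<Rightarrow> nat ^ 'd::finite"
    and t :: "'m::finite \<Rightarrow> nat ^ 'd"
    and \<phi>1 :: "('n, 'k::field) mpoly \<Rightarrow> ('d, 'k) mpoly"
    and \<phi>2 :: "('m, 'k) mpoly \<Rightarrow> ('d, 'k) mpoly"
    and \<phi> :: "('n + 'm, 'k) mpoly \<Rightarrow> ('d, 'k) mpoly"
    and i :: "'n \<Rightarrow> nat" and j :: "'m \<Rightarrow> nat"
    and w :: "nat ^ 'd"
  assumes S1: "S1 = monoid_gen (range s)"
    and S2: "S2 = monoid_gen (range t)"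
    and \<phi>1: "kalg_hom \<phi>1 (semigroup_ring S1)" "\<And>a. \<phi>1 (mp_var a) = mp_monom (s a)"
    and \<phi>2: "kalg_hom \<phi>2 (semigroup_ring S2)" "\<And>b. \<phi>2 (mp_var b) = mp_monom (t b)"
    and \<phi>: "kalg_hom \<phi> (semigroup_ring (S1 + S2))"
           "\<And>a. \<phi> (mp_var (Inl a)) = mp_monom (s a)" "\<And>b. \<phi> (mp_var (Inr b)) = mp_monom (t b)"
    and w: "w \<in> S1 \<inter> S2" "w \<noteq> 0"
           "w = (\<Sum>a\<in>UNIV. i a *s s a)" "w = (\<Sum>b\<in>UNIV. j b *s t b)"
  shows "ker \<phi> = ideal_gen (inclX ` ker \<phi>1) + ideal_gen (inclY ` ker \<phi>2)
                 + ideal_gen {(\<Prod>a\<in>UNIV. mp_var (Inl a) ^ i a) - (\<Prod>b\<in>UNIV. mp_var (Inr b) ^ j b)}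
         \<longleftrightarrow> Grp S1 \<inter> Grp S2 = Grp {k *s w | k. True}"
proof -
  define p :: "nat ^ 'n" where "p = (\<chi> a. i a)"
  define q :: "nat ^ 'm" where "q = (\<chi> b. j b)"
  have p: "wdeg s p = w" and q: "wdeg t q = w"
    using w(3,4) by (simp_all add: wdeg_def p_def q_def)
  have prod_sum_type: "(\<Prod>v\<in>UNIV. f v) = (\<Prod>a\<in>UNIV. f (Inl a)) * (\<Prod>b\<in>UNIV. f (Inr b))"
    for f :: "'n + 'm \<Rightarrow> ('n + 'm, 'k) mpoly"
    by (subst UNIV_Plus_UNIV[symmetric]) (simp add: prod.Plus del: UNIV_Plus_UNIV)
  have P: "(\<Prod>a\<in>UNIV. mp_var (Inl a) ^ i a) = (mp_monom (join p 0) :: ('n + 'm, 'k) mpoly)"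
    and Q: "(\<Prod>b\<in>UNIV. mp_var (Inr b) ^ j b) = (mp_monom (join 0 q) :: ('n + 'm, 'k) mpoly)"
    by (simp_all add: mp_monom_eq_prod_var prod_sum_type join_def p_def q_def)
  let ?d = "wdeg (case_sum s t) :: nat ^ ('n + 'm) \<Rightarrow> nat ^ 'd"
  have d: "?d e = wdeg s (partX e) + wdeg t (partY e)" for e
    by (simp add: wdeg_sum_type)
  have "\<phi> (mp_var v) = mp_monom (case_sum s t v)" for v
    using \<phi>(2,3) by (cases v) simp_all
  with \<phi>(1) have "\<phi> = pushforward ?d"
    by (rule kalg_hom_eq_pushforward)
  moreover have "\<phi>1 = pushforward (wdeg s)"
    using \<phi>1 by (rule kalg_hom_eq_pushforward)
  moreover have "\<phi>2 = pushforward (wdeg t)"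
    using \<phi>2 by (rule kalg_hom_eq_pushforward)
  moreover have "ker (pushforward (glue_rel s t w)) \<subseteq> (ker (pushforward ?d) :: ('n + 'm, 'k) mpoly set)"
    by (auto simp: ker_pushforward_subset_iff glue_rel_class_eq_iff d intro: glue_rel_wdeg)
  moreover have "(ker (pushforward ?d) :: ('n + 'm, 'k) mpoly set) \<subseteq> ker (pushforward (glue_rel s t w))
      \<longleftrightarrow> Grp S1 \<inter> Grp S2 = Grp {k *s w | k. True}"
    using w(1) unfolding S1 S2 monoid_gen_range ker_pushforward_subset_iff glue_rel_class_eq_iff d
    by (subst Grp_inter_eq_iff_glue_rel) auto
  ultimately show ?thesis
    by (simp only: P Q glued_ideal_eq_ker_pushforward[OF p q]) blast
qed

end
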